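(* Let $(V, V^+, e)$ be an order unit space with $V \neq \{0\}$, equipped with its order unit norm $\Vert\cdot\Vert$. Then $e$ is a norming order unit for $V$, and $V_e^+ = V^+$, where $$V_e^+ := \{ x \in V : \Vert 2 x - \Vert x \Vert e \Vert \le \Vert x \Vert \}.$$
   Context: Let $X$ be a non-zero real normed linear space and $e \in X$ with $\Vert e \Vert = 1$. We say $e$ is a norming order unit for $X$ if for every $x \in X$: $\Vert 2x - \Vert x \Vert e \Vert \le \Vert x \Vert$ whenever $\Vert 2x - \lambda e \Vert \le \lambda$ for some $\lambda \ge \Vert x \Vert$. A cone $V^+$ in a real vector space $V$ is a nonempty subset closed under addition and under multiplication by non-negative reals. An element $e \in V^+$ is an order unit if for every $v \in V$ there is a real $\lambda > 0$ with $\lambda e \pm v \in V^+$ (both signs). $V^+$ is proper if $V^+ \cap -V^+ = \{0\}$. $V^+$ is Archimedean if for every $v \in V$ such that $\lambda u + v \in V^+$ for some fixed $u \in V$ and all $\lambda > 0$, one has $v \in V^+$. An order unit space $(V, V^+, e)$ is a real vector space with a proper Archimedean cone $V^+$ and an order unit $e$; its order unit norm is $\Vert v \Vert = \Vert v \Vert_e := \inf\{ \lambda > 0 : \lambda e \pm v \in V^+ \}$. *)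

theory Defs
  imports "HOL-Analysis.Convex"
begin

(* The ambient real vector space is the whole type 'a::real_vector.  The norm under
   consideration is induced by a cone and an order unit, so norms are explicit functions
   'a => real rather than the norm of the class real_normed_vector. *)

definition is_norm :: "('a::real_vector \<Rightarrow> real) \<Rightarrow> bool" where
  "is_norm N \<longleftrightarrow>
     (\<forall>x. N x = 0 \<longleftrightarrow> x = 0) \<and>
     (\<forall>x y. N (x + y) \<le> N x + N y) \<and>
     (\<forall>a x. N (a *\<^sub>R x) = \<bar>a\<bar> * N x)"

definition norming_order_unit :: "('a::real_vector \<Rightarrow> real) \<Rightarrow> 'a \<Rightarrow> bool" where
  "norming_order_unit N e \<longleftrightarrow>
     (\<exists>x::'a. x \<noteq> 0) \<and> is_norm N \<and> N e = 1 \<and>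
     (\<forall>x. (\<exists>\<mu>\<ge>N x. N (2 *\<^sub>R x - \<mu> *\<^sub>R e) \<le> \<mu>)
        \<longrightarrow> N (2 *\<^sub>R x - N x *\<^sub>R e) \<le> N x)"

definition norm_cone :: "('a::real_vector \<Rightarrow> real) \<Rightarrow> 'a \<Rightarrow> 'a set" where
  "norm_cone N e = {x. N (2 *\<^sub>R x - N x *\<^sub>R e) \<le> N x}"

(* The library predicate cone only asks for closure under nonnegative scalars. *)
definition vector_cone :: "'a::real_vector set \<Rightarrow> bool" where
  "vector_cone P \<longleftrightarrow> P \<noteq> {} \<and> (\<forall>x\<in>P. \<forall>y\<in>P. x + y \<in> P) \<and> cone P"

definition order_unit :: "'a::real_vector set \<Rightarrow> 'a \<Rightarrow> bool" where
  "order_unit P e \<longleftrightarrow>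
     e \<in> P \<and> (\<forall>v. \<exists>\<mu>>0. \<mu> *\<^sub>R e + v \<in> P \<and> \<mu> *\<^sub>R e - v \<in> P)"

definition proper_cone :: "'a::real_vector set \<Rightarrow> bool" where
  "proper_cone P \<longleftrightarrow> vector_cone P \<and> P \<inter> uminus ` P = {0}"

definition archimedean_cone :: "'a::real_vector set \<Rightarrow> bool" where
  "archimedean_cone P \<longleftrightarrow> vector_cone P \<and>
     (\<forall>v. (\<exists>u. \<forall>\<mu>>0. \<mu> *\<^sub>R u + v \<in> P) \<longrightarrow> v \<in> P)"

definition order_unit_space :: "'a::real_vector set \<Rightarrow> 'a \<Rightarrow> bool" where
  "order_unit_space P e \<longleftrightarrow> proper_cone P \<and> archimedean_cone P \<and> order_unit P e"

definition order_unit_norm :: "'a::real_vector set \<Rightarrow> 'a \<Rightarrow> 'a \<Rightarrow> real" where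
  "order_unit_norm P e v =
     Inf {\<mu>. \<mu> > 0 \<and> \<mu> *\<^sub>R e + v \<in> P \<and> \<mu> *\<^sub>R e - v \<in> P}"

end

theory Submission
  imports Defs
begin

text \<open>
  Everything follows from a description of the closed balls of the order unit norm \<open>N\<close>: the
  infimum defining \<open>N v\<close> is attained, so that \<open>N v \<le> t\<close> holds exactly when \<open>t e + v\<close> and
  \<open>t e - v\<close> both lie in \<open>P\<close> (\<open>order_unit_norm_le_iff\<close>). The Archimedean property supplies the
  attainment.

  Applied to \<open>v = 2 x - t e\<close>, this says that \<open>N (2 x - t e) \<le> t\<close> holds exactly when \<open>2 x\<close> and
  \<open>2 (t e - x)\<close> lie in \<open>P\<close>, that is, when \<open>x\<close> lies in the order interval from \<open>0\<close> to \<open>t e\<close>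
  (\<open>order_interval_eq_ball\<close>). For \<open>t \<ge> N x\<close> the upper bound \<open>x \<le> t e\<close> is automatic, so the
  inequality just means \<open>x \<in> P\<close>, independently of \<open>t\<close>. This gives both claims: at \<open>t = N x\<close> it
  identifies the norm cone with \<open>P\<close>, and the independence of \<open>t\<close> is the norming condition.
\<close>

section \<open>Cones and order units\<close>

lemma order_unit_space_add:
  assumes "order_unit_space P e" "x \<in> P" "y \<in> P"
  shows "x + y \<in> P"
  using assms by (auto simp: order_unit_space_def proper_cone_def vector_cone_def)

lemma order_unit_space_scaleR:
  assumes "order_unit_space P e" "x \<in> P" "0 \<le> a"
  shows "a *\<^sub>R x \<in> P"
  using assms by (auto simp: order_unit_space_def proper_cone_def vector_cone_def cone_def)

lemma order_unit_space_scaleR_iff: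
  assumes "order_unit_space P e" "0 < a"
  shows "a *\<^sub>R x \<in> P \<longleftrightarrow> x \<in> P"
proof
  assume "a *\<^sub>R x \<in> P"
  with assms(2) have "inverse a *\<^sub>R (a *\<^sub>R x) \<in> P"
    using order_unit_space_scaleR[OF assms(1), of "a *\<^sub>R x" "inverse a"] by simp
  with assms(2) show "x \<in> P" by simp
next
  assume "x \<in> P"
  with assms show "a *\<^sub>R x \<in> P" by (simp add: order_unit_space_scaleR)
qed

lemma order_unit_space_antisym:
  assumes "order_unit_space P e" "x \<in> P" "- x \<in> P"
  shows "x = 0"
proof -
  have "x \<in> P \<inter> uminus ` P" using assms(2,3) by force
  with assms(1) show ?thesis by (auto simp: order_unit_space_def proper_cone_def)
qed

lemma order_unit_space_archimedean:
  assumes "order_unit_space P e" "\<And>\<delta>. 0 < \<delta> \<Longrightarrow> \<delta> *\<^sub>R e + v \<in> P"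
  shows "v \<in> P"
proof -
  have "\<exists>u. \<forall>\<mu>>0. \<mu> *\<^sub>R u + v \<in> P" using assms(2) by (intro exI[of _ e]) simp
  with assms(1) show ?thesis by (simp add: order_unit_space_def archimedean_cone_def)
qed

lemma order_unit_space_unit_mem:
  assumes "order_unit_space P e"
  shows "e \<in> P"
  using assms by (simp add: order_unit_space_def order_unit_def)

lemma order_unit_space_unit_mono:
  assumes "order_unit_space P e" "s *\<^sub>R e + v \<in> P" "s \<le> t"
  shows "t *\<^sub>R e + v \<in> P"
proof -
  have "(t - s) *\<^sub>R e + (s *\<^sub>R e + v) \<in> P"
    using order_unit_space_add[OF assms(1) order_unit_space_scaleR[OF assms(1)
          order_unit_space_unit_mem[OF assms(1)], of "t - s"] assms(2)] assms(3)
    by simp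
  then show ?thesis by (simp add: algebra_simps)
qed

lemma order_unit_space_unit_nonzero:
  fixes P :: "'a::real_vector set"
  assumes "order_unit_space P e" "\<exists>v::'a. v \<noteq> 0"
  shows "e \<noteq> 0"
proof
  assume "e = 0"
  obtain v :: 'a where "v \<noteq> 0" using assms(2) by blast
  moreover from assms(1) \<open>e = 0\<close> have "v \<in> P" "- v \<in> P"
    by (auto simp: order_unit_space_def order_unit_def)
  ultimately show False using order_unit_space_antisym[OF assms(1), of v] by simp
qed

lemma unit_multiple_mem_iff:
  fixes P :: "'a::real_vector set"
  assumes "order_unit_space P e" "\<exists>v::'a. v \<noteq> 0"
  shows "t *\<^sub>R e \<in> P \<longleftrightarrow> 0 \<le> t"
proof
  assume mem: "t *\<^sub>R e \<in> P"
  show "0 \<le> t"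
  proof (rule ccontr)
    assume "\<not> 0 \<le> t"
    then have "- (t *\<^sub>R e) \<in> P"
      using order_unit_space_scaleR[OF assms(1) order_unit_space_unit_mem[OF assms(1)], of "- t"]
      by simp
    with mem have "t *\<^sub>R e = 0" by (rule order_unit_space_antisym[OF assms(1)])
    with \<open>\<not> 0 \<le> t\<close> show False using order_unit_space_unit_nonzero[OF assms] by simp
  qed
next
  assume "0 \<le> t"
  then show "t *\<^sub>R e \<in> P"
    by (intro order_unit_space_scaleR[OF assms(1)] order_unit_space_unit_mem[OF assms(1)])
qed

lemma symmetric_interval_radius_nonneg:
  fixes P :: "'a::real_vector set"
  assumes "order_unit_space P e" "\<exists>v::'a. v \<noteq> 0"
    and "t *\<^sub>R e + v \<in> P" "t *\<^sub>R e - v \<in> P"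
  shows "0 \<le> t"
proof -
  have "t *\<^sub>R e + t *\<^sub>R e \<in> P"
    using order_unit_space_add[OF assms(1,3,4)] by simp
  then have "(t + t) *\<^sub>R e \<in> P" by (simp only: scaleR_left_distrib)
  then show ?thesis using unit_multiple_mem_iff[OF assms(1,2), of "t + t"] by simp
qed

section \<open>Closed balls of the order unit norm\<close>

text \<open>
  If \<open>N v \<le> t\<close>, then \<open>t + \<delta>\<close> exceeds an admissible scalar for every \<open>\<delta> > 0\<close>, so \<open>\<delta> e + (t e \<plusminus> v)\<close>
  lies in \<open>P\<close> and the Archimedean property removes \<open>\<delta> e\<close>. Conversely, \<open>t e \<plusminus> v \<in> P\<close> forces
  \<open>2 t e \<in> P\<close>, hence \<open>t \<ge> 0\<close>, and then every \<open>t + \<delta>\<close> with \<open>\<delta> > 0\<close> is admissible. The space has to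
  be nonzero: in the zero space the right-hand side is true even for negative \<open>t\<close>.
\<close>

lemma order_unit_norm_le_iff:
  fixes P :: "'a::real_vector set"
  assumes "order_unit_space P e" "\<exists>v::'a. v \<noteq> 0"
  shows "order_unit_norm P e v \<le> t \<longleftrightarrow> t *\<^sub>R e + v \<in> P \<and> t *\<^sub>R e - v \<in> P"
proof -
  define S where "S = {\<mu>. \<mu> > 0 \<and> \<mu> *\<^sub>R e + v \<in> P \<and> \<mu> *\<^sub>R e - v \<in> P}"
  have N: "order_unit_norm P e v = Inf S"
    by (simp add: order_unit_norm_def S_def)
  have ne: "S \<noteq> {}"
    using assms(1) unfolding S_def order_unit_space_def order_unit_def by blast
  have bdd: "bdd_below S" by (auto simp: S_def intro: bdd_belowI[of _ 0])
  show ?thesis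
  proof
    assume le: "order_unit_norm P e v \<le> t"
    have "\<delta> *\<^sub>R e + (t *\<^sub>R e + v) \<in> P \<and> \<delta> *\<^sub>R e + (t *\<^sub>R e - v) \<in> P" if "0 < \<delta>" for \<delta>
    proof -
      have "Inf S < t + \<delta>" using le N that by simp
      then obtain \<mu> where \<mu>: "\<mu> \<in> S" "\<mu> < t + \<delta>"
        unfolding cInf_less_iff[OF ne bdd] by blast
      have "(t + \<delta>) *\<^sub>R e + v \<in> P"
        using \<mu> order_unit_space_unit_mono[OF assms(1), of \<mu> v "t + \<delta>"]
        by (simp add: S_def)
      moreover have "(t + \<delta>) *\<^sub>R e + - v \<in> P"
        using \<mu> order_unit_space_unit_mono[OF assms(1), of \<mu> "- v" "t + \<delta>"]
        by (simp add: S_def)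
      ultimately show ?thesis by (simp add: algebra_simps)
    qed
    then show "t *\<^sub>R e + v \<in> P \<and> t *\<^sub>R e - v \<in> P"
      using order_unit_space_archimedean[OF assms(1), of "t *\<^sub>R e + v"]
        order_unit_space_archimedean[OF assms(1), of "t *\<^sub>R e - v"] by simp
  next
    assume mem: "t *\<^sub>R e + v \<in> P \<and> t *\<^sub>R e - v \<in> P"
    then have t: "0 \<le> t" using symmetric_interval_radius_nonneg[OF assms] by blast
    have "Inf S \<le> t + \<delta>" if "0 < \<delta>" for \<delta>
    proof -
      have "(t + \<delta>) *\<^sub>R e + v \<in> P" "(t + \<delta>) *\<^sub>R e + - v \<in> P"
        using mem that order_unit_space_unit_mono[OF assms(1), of t v "t + \<delta>"]
          order_unit_space_unit_mono[OF assms(1), of t "- v" "t + \<delta>"] by simp_all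
      then have "t + \<delta> \<in> S" using t that by (simp add: S_def)
      then show ?thesis using bdd by (rule cInf_lower)
    qed
    then show "order_unit_norm P e v \<le> t" unfolding N by (rule field_le_epsilon)
  qed
qed

text \<open>
  The order interval from \<open>0\<close> to \<open>t e\<close> is the closed ball of radius \<open>t / 2\<close> about its midpoint.
\<close>

lemma order_interval_eq_ball:
  fixes P :: "'a::real_vector set"
  assumes "order_unit_space P e" "\<exists>v::'a. v \<noteq> 0"
  shows "order_unit_norm P e (2 *\<^sub>R x - t *\<^sub>R e) \<le> t \<longleftrightarrow> x \<in> P \<and> t *\<^sub>R e - x \<in> P"
proof -
  have "t *\<^sub>R e + (2 *\<^sub>R x - t *\<^sub>R e) = 2 *\<^sub>R x"
    "t *\<^sub>R e - (2 *\<^sub>R x - t *\<^sub>R e) = 2 *\<^sub>R (t *\<^sub>R e - x)"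
    by (simp only: scaleR_2, simp add: algebra_simps)+
  then show ?thesis
    using order_unit_norm_le_iff[OF assms, of "2 *\<^sub>R x - t *\<^sub>R e" t]
      order_unit_space_scaleR_iff[OF assms(1), of 2] by simp
qed

lemma positive_iff_order_unit_norm_le:
  fixes P :: "'a::real_vector set"
  assumes "order_unit_space P e" "\<exists>v::'a. v \<noteq> 0" "order_unit_norm P e x \<le> t"
  shows "order_unit_norm P e (2 *\<^sub>R x - t *\<^sub>R e) \<le> t \<longleftrightarrow> x \<in> P"
  using assms(3) order_interval_eq_ball[OF assms(1,2), of x t]
    order_unit_norm_le_iff[OF assms(1,2), of x t]
  by blast

section \<open>The order unit norm is a norm\<close>

lemma order_unit_norm_bounds:
  fixes P :: "'a::real_vector set"
  assumes "order_unit_space P e" "\<exists>v::'a. v \<noteq> 0"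
  shows "order_unit_norm P e x *\<^sub>R e + x \<in> P" "order_unit_norm P e x *\<^sub>R e - x \<in> P"
  using order_unit_norm_le_iff[OF assms, of x "order_unit_norm P e x"] by auto

lemma order_unit_norm_nonneg:
  fixes P :: "'a::real_vector set"
  assumes "order_unit_space P e" "\<exists>v::'a. v \<noteq> 0"
  shows "0 \<le> order_unit_norm P e x"
  by (rule symmetric_interval_radius_nonneg[OF assms order_unit_norm_bounds[OF assms]])

lemma order_unit_norm_eq_0_iff:
  fixes P :: "'a::real_vector set"
  assumes "order_unit_space P e" "\<exists>v::'a. v \<noteq> 0"
  shows "order_unit_norm P e x = 0 \<longleftrightarrow> x = 0"
proof
  assume "order_unit_norm P e x = 0"
  then show "x = 0"
    using order_unit_norm_bounds[OF assms, of x] order_unit_space_antisym[OF assms(1), of x] by simp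
next
  assume "x = 0"
  then have "order_unit_norm P e x \<le> 0"
    using order_unit_norm_le_iff[OF assms, of x 0] unit_multiple_mem_iff[OF assms, of 0] by simp
  then show "order_unit_norm P e x = 0" using order_unit_norm_nonneg[OF assms, of x] by simp
qed

lemma order_unit_norm_triangle:
  fixes P :: "'a::real_vector set"
  assumes "order_unit_space P e" "\<exists>v::'a. v \<noteq> 0"
  shows "order_unit_norm P e (x + y) \<le> order_unit_norm P e x + order_unit_norm P e y"
proof -
  let ?N = "order_unit_norm P e"
  have "(?N x *\<^sub>R e + x) + (?N y *\<^sub>R e + y) \<in> P" "(?N x *\<^sub>R e - x) + (?N y *\<^sub>R e - y) \<in> P"
    by (rule order_unit_space_add[OF assms(1)]; rule order_unit_norm_bounds[OF assms])+
  then show ?thesis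
    by (simp add: order_unit_norm_le_iff[OF assms] algebra_simps)
qed

lemma order_unit_norm_scaleR_le:
  fixes P :: "'a::real_vector set"
  assumes "order_unit_space P e" "\<exists>v::'a. v \<noteq> 0"
  shows "order_unit_norm P e (a *\<^sub>R x) \<le> \<bar>a\<bar> * order_unit_norm P e x"
proof -
  let ?N = "order_unit_norm P e"
  have "\<bar>a\<bar> *\<^sub>R (?N x *\<^sub>R e + x) \<in> P" "\<bar>a\<bar> *\<^sub>R (?N x *\<^sub>R e - x) \<in> P"
    by (rule order_unit_space_scaleR[OF assms(1) _ abs_ge_zero], rule order_unit_norm_bounds[OF assms])+
  then show ?thesis
    by (cases "0 \<le> a")
      (simp_all add: order_unit_norm_le_iff[OF assms] scaleR_right_distrib scaleR_right_diff_distrib)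
qed

lemma order_unit_norm_scaleR:
  fixes P :: "'a::real_vector set"
  assumes "order_unit_space P e" "\<exists>v::'a. v \<noteq> 0"
  shows "order_unit_norm P e (a *\<^sub>R x) = \<bar>a\<bar> * order_unit_norm P e x"
proof (cases "a = 0")
  case True
  then show ?thesis using order_unit_norm_eq_0_iff[OF assms, of 0] by simp
next
  case False
  then have "order_unit_norm P e x \<le> \<bar>inverse a\<bar> * order_unit_norm P e (a *\<^sub>R x)"
    using order_unit_norm_scaleR_le[OF assms, of "inverse a" "a *\<^sub>R x"] by simp
  with False have "\<bar>a\<bar> * order_unit_norm P e x \<le> order_unit_norm P e (a *\<^sub>R x)"
    by (simp add: field_simps)
  with order_unit_norm_scaleR_le[OF assms, of a x] show ?thesis by simp
qed

lemma is_norm_order_unit_norm: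
  fixes P :: "'a::real_vector set"
  assumes "order_unit_space P e" "\<exists>v::'a. v \<noteq> 0"
  shows "is_norm (order_unit_norm P e)"
  unfolding is_norm_def
  by (simp add: order_unit_norm_eq_0_iff[OF assms] order_unit_norm_triangle[OF assms]
      order_unit_norm_scaleR[OF assms])

lemma order_unit_norm_unit:
  fixes P :: "'a::real_vector set"
  assumes "order_unit_space P e" "\<exists>v::'a. v \<noteq> 0"
  shows "order_unit_norm P e e = 1"
proof (rule antisym)
  have "2 *\<^sub>R e \<in> P" "0 *\<^sub>R e \<in> P"
    using unit_multiple_mem_iff[OF assms] by (simp_all only: order_refl zero_le_numeral)
  then show "order_unit_norm P e e \<le> 1"
    using order_unit_norm_le_iff[OF assms, of e 1]
    by (simp add: scaleR_2)
  have "(order_unit_norm P e e - 1) *\<^sub>R e \<in> P"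
    using order_unit_norm_bounds(2)[OF assms, of e] by (simp add: scaleR_left_diff_distrib)
  then show "1 \<le> order_unit_norm P e e" using unit_multiple_mem_iff[OF assms] by simp
qed

section \<open>The norming property and the norm cone\<close>

theorem corollary3p4:
  fixes P :: "'a::real_vector set" and e :: 'a
  assumes "order_unit_space P e"
    and "\<exists>v::'a. v \<noteq> 0"
  shows "norming_order_unit (order_unit_norm P e) e
    \<and> norm_cone (order_unit_norm P e) e = P"
proof
  show "norming_order_unit (order_unit_norm P e) e"
    unfolding norming_order_unit_def
    using assms(2) is_norm_order_unit_norm[OF assms] order_unit_norm_unit[OF assms]
    by (auto simp: positive_iff_order_unit_norm_le[OF assms])
  show "norm_cone (order_unit_norm P e) e = P"
    by (simp add: norm_cone_def positive_iff_order_unit_norm_le[OF assms])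
qed

end
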